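(* Let $n\in\mathbb{N}$, $n\ge 1$, and let $\mathfrak{S}\subset GL(n+1,\mathbb{R})$ be a (nonempty) semigroup under matrix multiplication. Let $\mathcal{D}=\{r\,\mathrm{Id}\mid r\in\mathbb{R}\setminus\{0\}\}$ be the centre of $GL(n+1,\mathbb{R})$. Then the following are equivalent: (a) $\mathfrak{S}$ acts distally on the unit sphere $\mathbb{S}^n$ (via $T\mapsto\overline{T}$). (b) The closure of $\mathfrak{S}\mathcal{D}/\mathcal{D}$ in the quotient topological group $GL(n+1,\mathbb{R})/\mathcal{D}$ is a compact group. (c) For the semigroup $\mathfrak{S}'=\{\alpha_T T\mid T\in\mathfrak{S}\}$, where $\alpha_T=|\det T|^{-1/(n+1)}$, the closure of $\mathfrak{S}'$ in $GL(n+1,\mathbb{R})$ is a compact group.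
   Context: $\mathbb{S}^n$ is the unit sphere of $\mathbb{R}^{n+1}$ for the Euclidean norm $\|\cdot\|$. For $T\in GL(n+1,\mathbb{R})$, the homeomorphism $\overline{T}:\mathbb{S}^n\to\mathbb{S}^n$ is defined by $\overline{T}(x)=T(x)/\|T(x)\|$; the map $(T,x)\mapsto\overline{T}(x)$ is a continuous group action of $GL(n+1,\mathbb{R})$ on $\mathbb{S}^n$, and $\mathfrak{S}$ acts on $\mathbb{S}^n$ through it. A semigroup $\mathfrak{S}$ acting by homeomorphisms on a Hausdorff space $X$ acts distally on $X$ if for every pair of distinct points $x,y\in X$, the closure of $\{(T(x),T(y))\mid T\in\mathfrak{S}\}$ in $X\times X$ does not intersect the diagonal $\{(d,d)\mid d\in X\}$. *)

theory Defs
  imports "HOL-Analysis.Analysis" "HOL-Algebra.Coset"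
begin

section \<open>Quotient topology and compact subgroups\<close>

definition quotient_topology :: "'a topology \<Rightarrow> ('a \<Rightarrow> 'b) \<Rightarrow> 'b topology" where
  "quotient_topology X f =
     topology (\<lambda>U. U \<subseteq> f ` topspace X \<and> openin X {x \<in> topspace X. f x \<in> U})"

lemma openin_quotient_topology:
  "openin (quotient_topology X f) U \<longleftrightarrow>
     U \<subseteq> f ` topspace X \<and> openin X {x \<in> topspace X. f x \<in> U}"
proof -
  let ?P = "\<lambda>U. U \<subseteq> f ` topspace X \<and> openin X {x \<in> topspace X. f x \<in> U}"
  have "istopology ?P"
    unfolding istopology_def
  proof (intro conjI allI impI)
    fix U V assume U: "?P U" and V: "?P V"
    have "{x \<in> topspace X. f x \<in> U \<inter> V} =
          {x \<in> topspace X. f x \<in> U} \<inter> {x \<in> topspace X. f x \<in> V}" by auto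
    then show "openin X {x \<in> topspace X. f x \<in> U \<inter> V}" using U V by auto
    show "U \<inter> V \<subseteq> f ` topspace X" using U by auto
  next
    fix \<K> assume K: "\<forall>U\<in>\<K>. ?P U"
    have "{x \<in> topspace X. f x \<in> \<Union>\<K>} = (\<Union>U\<in>\<K>. {x \<in> topspace X. f x \<in> U})" by auto
    then show "openin X {x \<in> topspace X. f x \<in> \<Union>\<K>}" using K by auto
    show "\<Union>\<K> \<subseteq> f ` topspace X" using K by auto
  qed
  then show ?thesis by (simp add: quotient_topology_def topology_inverse')
qed

lemma topspace_quotient_topology [simp]:
  "topspace (quotient_topology X f) = f ` topspace X"
proof
  show "topspace (quotient_topology X f) \<subseteq> f ` topspace X"
    using openin_topspace[of "quotient_topology X f"] by (simp only: openin_quotient_topology)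
  have "{x \<in> topspace X. f x \<in> f ` topspace X} = topspace X" by auto
  then have "openin (quotient_topology X f) (f ` topspace X)"
    by (simp add: openin_quotient_topology)
  then show "f ` topspace X \<subseteq> topspace (quotient_topology X f)"
    by (rule openin_subset)
qed

lemma quotient_map_quotient_topology: "quotient_map X (quotient_topology X f) f"
  by (auto simp: quotient_map_def openin_quotient_topology)

text \<open>
  A subgroup of a topological group is a topological group in the subspace topology,
  so a subset of the ambient topological group is a compact group iff it is a subgroup
  and a compact subset.
\<close>

definition compact_group_in :: "('a, 'b) monoid_scheme \<Rightarrow> 'a topology \<Rightarrow> 'a set \<Rightarrow> bool" where
  "compact_group_in G X C \<longleftrightarrow> subgroup C G \<and> compactin X C"


section \<open>The general linear group and its quotient by the scalars\<close>

definition GL :: "(real^'n^'n) monoid" where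
  "GL = \<lparr>carrier = {A. invertible A}, monoid.mult = (**), one = mat 1\<rparr>"

definition GL_topology :: "(real^'n^'n) topology" where
  "GL_topology = top_of_set (carrier GL)"

definition scalars :: "(real^'n^'n) set" where
  "scalars = {r *\<^sub>R mat 1 | r. r \<noteq> 0}"

definition PGL_topology :: "(real^'n^'n) set topology" where
  "PGL_topology = quotient_topology GL_topology (\<lambda>A. scalars #>\<^bsub>GL\<^esub> A)"

lemma group_GL: "group (GL :: (real^'n^'n) monoid)"
proof (rule groupI)
  fix A :: "real^'n^'n" assume "A \<in> carrier GL"
  then obtain B where "A ** B = mat 1" "B ** A = mat 1"
    by (auto simp: GL_def invertible_def)
  then show "\<exists>B\<in>carrier GL. B \<otimes>\<^bsub>GL\<^esub> A = \<one>\<^bsub>GL\<^esub>"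
    by (intro bexI[of _ B]) (auto simp: GL_def invertible_def)
next
  show "\<one>\<^bsub>GL\<^esub> \<in> carrier (GL :: (real^'n^'n) monoid)"
    by (auto simp: GL_def invertible_def intro: exI[of _ "mat 1"])
qed (auto simp: GL_def invertible_mult matrix_mul_assoc)

lemma scalars_normal: "normal (scalars :: (real^'n^'n) set) GL"
proof -
  interpret group "GL :: (real^'n^'n) monoid" by (rule group_GL)
  have inv: "invertible (r *\<^sub>R mat 1 :: real^'n^'n)" if "r \<noteq> 0" for r :: real
    unfolding invertible_def
    by (rule exI[of _ "(1/r) *\<^sub>R mat 1"])
       (use that in \<open>simp add: scalar_matrix_assoc matrix_scalar_ac\<close>)
  have sub: "subgroup (scalars :: (real^'n^'n) set) GL"
  proof (rule subgroupI)
    show "scalars \<subseteq> carrier (GL :: (real^'n^'n) monoid)"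
      using inv by (auto simp: scalars_def GL_def)
    show "(scalars :: (real^'n^'n) set) \<noteq> {}"
      by (auto simp: scalars_def intro: exI[of _ 1])
  next
    fix a :: "real^'n^'n" assume "a \<in> scalars"
    then obtain r where r: "r \<noteq> 0" "a = r *\<^sub>R mat 1" by (auto simp: scalars_def)
    have "inv\<^bsub>GL\<^esub> a = (1/r) *\<^sub>R mat 1"
      by (rule inv_equality)
         (use r inv[of r] inv[of "1/r"] in
           \<open>auto simp: GL_def scalar_matrix_assoc matrix_scalar_ac\<close>)
    then show "inv\<^bsub>GL\<^esub> a \<in> scalars" using r by (auto simp: scalars_def)
  next
    fix a b :: "real^'n^'n" assume "a \<in> scalars" "b \<in> scalars"
    then obtain r s where "r \<noteq> 0" "a = r *\<^sub>R mat 1" "s \<noteq> 0" "b = s *\<^sub>R mat 1"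
      by (auto simp: scalars_def)
    then show "a \<otimes>\<^bsub>GL\<^esub> b \<in> scalars"
      by (auto simp: scalars_def GL_def scalar_matrix_assoc matrix_scalar_ac
          intro!: exI[of _ "r * s"])
  qed
  have "(r *\<^sub>R mat 1) ** A = A ** (r *\<^sub>R mat 1)" for r and A :: "real^'n^'n"
    by (simp add: matrix_scalar_ac flip: scalar_matrix_assoc)
  then have "scalars #>\<^bsub>GL\<^esub> A = A <#\<^bsub>GL\<^esub> scalars" for A :: "real^'n^'n"
    unfolding r_coset_def l_coset_def
    by (intro SUP_cong refl) (auto simp: GL_def scalars_def)
  then show ?thesis
    by (intro normalI sub ballI)
qed

lemma topspace_PGL_topology:
  "topspace PGL_topology = carrier (GL Mod (scalars :: (real^'n^'n) set))"
  by (auto simp: PGL_topology_def GL_topology_def carrier_FactGroup)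


section \<open>Semigroups and distal actions\<close>

definition matrix_semigroup :: "(real^'n^'n) set \<Rightarrow> bool" where
  "matrix_semigroup S \<longleftrightarrow>
     S \<noteq> {} \<and> S \<subseteq> carrier GL \<and> (\<forall>A\<in>S. \<forall>B\<in>S. A ** B \<in> S)"

definition acts_distally :: "'s set \<Rightarrow> ('s \<Rightarrow> 'x \<Rightarrow> 'x) \<Rightarrow> 'x topology \<Rightarrow> bool" where
  "acts_distally S act X \<longleftrightarrow>
     (\<forall>x\<in>topspace X. \<forall>y\<in>topspace X. x \<noteq> y \<longrightarrow>
        (prod_topology X X closure_of {(act T x, act T y) | T. T \<in> S})
          \<inter> {(d, d) | d. d \<in> topspace X} = {})"

definition sphere_map :: "real^'n^'n \<Rightarrow> real^'n \<Rightarrow> real^'n" where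
  "sphere_map T x = (T *v x) /\<^sub>R norm (T *v x)"

definition det_normalize :: "real^'n^'n \<Rightarrow> real^'n^'n" where
  "det_normalize T = (\<bar>det T\<bar> powr (- 1 / real CARD('n))) *\<^sub>R T"

end

(* All three conditions are equivalent to boundedness of the normalised semigroup S'.
   If T_k in S' is unbounded, then T_k / |T_k| subconverges to a nonzero singular matrix A,
   since |det T_k| = 1; for v in ker A and x not in ker A, the directions of x and x + v are
   then brought together, so the action is not distal.  Conversely, a bounded S' has a compact
   closure consisting of matrices with |det| = 1, and a compact subsemigroup of a group is a group. *)

theory Submission
  imports Defs
begin

section \<open>Continuity of matrix operations\<close>

lemma continuous_on_det [continuous_intros]:
  fixes f :: "'a::topological_space \<Rightarrow> real^'n^'n"
  assumes "continuous_on X f"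
  shows "continuous_on X (\<lambda>x. det (f x))"
  unfolding det_def by (intro continuous_intros assms)

lemma tendsto_det [tendsto_intros]:
  fixes f :: "'a \<Rightarrow> real^'n^'n"
  assumes "(f \<longlongrightarrow> A) F"
  shows "((\<lambda>x. det (f x)) \<longlongrightarrow> det A) F"
  unfolding det_def by (intro tendsto_intros assms)

lemma tendsto_matrix_matrix_mult [tendsto_intros]:
  fixes f :: "'a \<Rightarrow> real^'n^'m" and g :: "'a \<Rightarrow> real^'p^'n"
  assumes "(f \<longlongrightarrow> A) F" "(g \<longlongrightarrow> B) F"
  shows "((\<lambda>x. f x ** g x) \<longlongrightarrow> A ** B) F"
  unfolding matrix_matrix_mult_def by (intro tendsto_intros assms)

lemma continuous_on_matrix_vector_mult_left:
  fixes f :: "'a::topological_space \<Rightarrow> real^'n^'m"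
  assumes "continuous_on X f"
  shows "continuous_on X (\<lambda>x. f x *v v)"
  unfolding matrix_vector_mult_def by (intro continuous_intros assms)

lemma tendsto_matrix_vector_mult_left [tendsto_intros]:
  fixes f :: "'a \<Rightarrow> real^'n^'m"
  assumes "(f \<longlongrightarrow> A) F"
  shows "((\<lambda>x. f x *v v) \<longlongrightarrow> A *v v) F"
  unfolding matrix_vector_mult_def by (intro tendsto_intros assms)

lemma det_scaleR:
  fixes A :: "real^'n^'n"
  shows "det (c *\<^sub>R A) = c ^ CARD('n) * det A"
proof -
  have "c *\<^sub>R A = (\<chi> i. c *s A $ i)"
    by (simp add: vec_eq_iff)
  then show ?thesis
    by (simp add: det_rows_mul)
qed

section \<open>Normalisation by the determinant\<close>

lemma scaleR_matrix_mult:
  fixes A :: "real^'n^'m" and B :: "real^'p^'n"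
  shows "(a *\<^sub>R A) ** (b *\<^sub>R B) = (a * b) *\<^sub>R (A ** B)"
  by (simp add: vec_eq_iff matrix_matrix_mult_def sum_distrib_left mult_ac)

lemma mem_carrier_GL: "A \<in> carrier GL \<longleftrightarrow> det A \<noteq> 0"
  by (simp add: GL_def invertible_det_nz)

lemma mult_GL: "A \<otimes>\<^bsub>GL\<^esub> B = A ** B"
  by (simp add: GL_def)

lemma abs_det_det_normalize:
  fixes A :: "real^'n^'n"
  assumes "det A \<noteq> 0"
  shows "\<bar>det (det_normalize A)\<bar> = 1"
proof -
  have "\<bar>det (det_normalize A)\<bar> =
      (\<bar>det A\<bar> powr (- 1 / real CARD('n))) powr real CARD('n) * \<bar>det A\<bar>"
    using assms by (simp add: det_normalize_def det_scaleR abs_mult powr_realpow)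
  also have "\<dots> = \<bar>det A\<bar> powr (- 1) * \<bar>det A\<bar>"
    by (simp only: powr_powr) simp
  also have "\<dots> = 1"
    using assms by (simp add: powr_minus)
  finally show ?thesis .
qed

lemma det_normalize_mult:
  "det_normalize (A ** B) = det_normalize A ** det_normalize B"
  by (simp add: det_normalize_def det_mul abs_mult powr_mult scaleR_matrix_mult)

text \<open>The normalising factor absorbs the modulus of \<open>r\<close> but not its sign.
  Matrices in one coset of \<open>scalars\<close> therefore have normalisations that agree up to
  sign.\<close>

lemma det_normalize_scaleR:
  fixes A :: "real^'n^'n"
  assumes "r \<noteq> 0"
  shows "det_normalize (r *\<^sub>R A) = sgn r *\<^sub>R det_normalize A"
proof -
  have "(\<bar>r\<bar> ^ CARD('n)) powr (- 1 / real CARD('n)) = \<bar>r\<bar> powr (- 1)"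
    using assms by (simp add: powr_powr flip: powr_realpow)
  then have "det_normalize (r *\<^sub>R A) = (\<bar>r\<bar> powr (- 1) * r) *\<^sub>R det_normalize A"
    by (simp add: det_normalize_def det_scaleR abs_mult power_abs powr_mult)
  moreover have "\<bar>r\<bar> powr (- 1) * r = sgn r"
    using assms by (simp add: powr_minus sgn_if field_simps)
  ultimately show ?thesis by simp
qed

lemma det_normalize_eq_self:
  assumes "\<bar>det A\<bar> = 1"
  shows "det_normalize A = A"
  using assms by (simp add: det_normalize_def)

text \<open>Later invariance arguments use only that the factor is positive: such a factor changes
  neither the map on the sphere nor the coset modulo \<open>scalars\<close>.\<close>

lemma det_normalize_scaled:
  fixes A :: "real^'a^'a"
  assumes "det A \<noteq> 0"
  obtains r where "r > 0" "det_normalize A = r *\<^sub>R A"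
proof (rule that)
  show "\<bar>det A\<bar> powr (- 1 / real CARD('a)) > 0"
    using assms by simp
qed (rule det_normalize_def)

lemma continuous_on_det_normalize:
  "continuous_on (carrier GL) det_normalize"
  unfolding det_normalize_def
  by (intro continuous_intros) (auto simp: mem_carrier_GL)

section \<open>The induced action on the sphere\<close>

lemma sphere_map_scaleR:
  assumes "r > 0"
  shows "sphere_map (r *\<^sub>R A) x = sphere_map A x"
  using assms by (simp add: sphere_map_def flip: scaleR_matrix_vector_assoc)

lemma sphere_map_scaleR_right:
  assumes "r > 0"
  shows "sphere_map A (r *\<^sub>R x) = sphere_map A x"
  using assms by (simp add: sphere_map_def matrix_vector_mult_scaleR)

lemma sphere_map_det_normalize:
  assumes "det A \<noteq> 0"
  shows "sphere_map (det_normalize A) x = sphere_map A x"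
  by (rule det_normalize_scaled[OF assms]) (simp add: sphere_map_scaleR)

text \<open>The limit \<open>A\<close> may be singular: it is enough that \<open>x\<close> lies
  outside its kernel. This is what makes a limit of normalised matrices usable when its determinant
  vanishes.\<close>

lemma tendsto_sphere_map:
  assumes "(f \<longlongrightarrow> A) F" "A *v x \<noteq> 0"
  shows "((\<lambda>k. sphere_map (f k) x) \<longlongrightarrow> sphere_map A x) F"
  unfolding sphere_map_def using assms by (intro tendsto_intros) auto

lemma matrix_vector_mult_eq_0_iff:
  fixes A :: "real^'n^'n"
  assumes "det A \<noteq> 0"
  shows "A *v x = 0 \<longleftrightarrow> x = 0"
  using assms inj_matrix_vector_mult[of A]
  by (metis inj_eq invertible_det_nz matrix_vector_mult_0_right)

lemma sphere_map_in_sphere: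
  assumes "det A \<noteq> 0" "x \<noteq> 0"
  shows "sphere_map A x \<in> sphere 0 1"
  using assms by (simp add: sphere_map_def matrix_vector_mult_eq_0_iff)

text \<open>If the images agree, then \<open>A\<close> sends positive multiples of \<open>x\<close>
  and \<open>y\<close> to the same vector. Injectivity of \<open>A\<close> puts \<open>x\<close> and
  \<open>y\<close> on one ray, which meets the unit sphere once.\<close>

lemma sphere_map_inj:
  assumes "det A \<noteq> 0" "x \<in> sphere 0 1" "y \<in> sphere 0 1" "sphere_map A x = sphere_map A y"
  shows "x = y"
proof -
  define a b where "a = inverse (norm (A *v x))" and "b = inverse (norm (A *v y))"
  have ab: "a > 0" "b > 0"
    using assms(1-3) by (auto simp: a_def b_def matrix_vector_mult_eq_0_iff)
  have "A *v (a *\<^sub>R x) = A *v (b *\<^sub>R y)"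
    using assms(4) by (simp add: sphere_map_def a_def b_def matrix_vector_mult_scaleR)
  then have eq: "a *\<^sub>R x = b *\<^sub>R y"
    using assms(1) inj_matrix_vector_mult[of A] by (simp add: inj_eq invertible_det_nz)
  then have "norm (a *\<^sub>R x) = norm (b *\<^sub>R y)" by simp
  then have "a = b" using assms(2,3) ab by simp
  with eq ab show ?thesis by simp
qed

section \<open>Distal actions\<close>

text \<open>This trades the closure in the product of two subspace topologies for a Euclidean
  closure, so that sequences apply. The intersection with the product of spheres comes from
  \<open>closure_of_subtopology\<close>.\<close>

lemma acts_distally_sphere_iff:
  fixes S :: "(real^'n^'n) set"
  shows
  "acts_distally S sphere_map (top_of_set (sphere 0 1)) \<longleftrightarrow>
    (\<forall>x\<in>sphere 0 1. \<forall>y\<in>sphere 0 1. x \<noteq> y \<longrightarrow>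
      (\<forall>d\<in>sphere 0 1. (d, d) \<notin> closure (sphere 0 1 \<times> sphere 0 1 \<inter>
        {(sphere_map T x, sphere_map T y) | T. T \<in> S})))"
proof -
  have "prod_topology (top_of_set s) (top_of_set s) closure_of P \<inter> {(d, d) | d. d \<in> s} = {} \<longleftrightarrow>
      (\<forall>d\<in>s. (d, d) \<notin> closure (s \<times> s \<inter> P))"
    for s :: "(real^'n) set" and P
    unfolding prod_topology_subtopology_eu closure_of_subtopology euclidean_closure_of by blast
  then show ?thesis
    by (simp only: acts_distally_def topspace_euclidean_subtopology)
qed

lemma bounded_det_normalize_if_distal:
  fixes S :: "(real^'n^'n) set"
  assumes S: "S \<subseteq> carrier GL"
    and distal: "acts_distally S sphere_map (top_of_set (sphere 0 1))"
  shows "bounded (det_normalize ` S)"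
proof (rule ccontr)
  assume "\<not> bounded (det_normalize ` S)"
  \<comment> \<open>The shift by 1 makes every norm exceed 1, so that below \<open>c k\<close> is at
    most 1 as well as at most \<open>inverse (real (Suc k))\<close>.\<close>
  then have "\<exists>T\<in>S. norm (det_normalize T) > real k + 1" for k :: nat
    unfolding bounded_iff by (auto simp: not_le)
  then obtain T where T: "\<And>k. T k \<in> S" "\<And>k. norm (det_normalize (T k)) > real k + 1"
    by metis
  \<comment> \<open>Rescaling to norm 1 leaves the action unchanged and puts the sequence into a
    compact sphere of matrices, while the determinants shrink by
    \<open>c k ^ CARD('n)\<close>.\<close>
  define c where "c k = inverse (norm (det_normalize (T k)))" for k
  define B where "B k = c k *\<^sub>R det_normalize (T k)" for k
  have det_T: "det (T k) \<noteq> 0" for k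
    using S T(1) by (auto simp: mem_carrier_GL subset_iff)
  have norm_pos: "norm (det_normalize (T k)) > 1" for k
    using T(2)[of k] by linarith
  have c: "0 < c k" "c k \<le> 1" "c k \<le> inverse (real (Suc k))" for k
    using norm_pos[of k] T(2)[of k]
    by (auto simp: c_def inverse_le_1_iff intro!: le_imp_inverse_le)
  have norm_B: "norm (B k) = 1" for k
  proof -
    have "norm (det_normalize (T k)) \<noteq> 0" using norm_pos[of k] by linarith
    then show ?thesis by (simp add: B_def c_def)
  qed
  have "\<bar>det (B k)\<bar> = c k ^ CARD('n)" for k
    using abs_det_det_normalize[OF det_T] c(1)[of k] by (simp add: B_def det_scaleR abs_mult)
  moreover have "c k ^ CARD('n) \<le> c k" for k
    using power_decreasing[of 1 "CARD('n)" "c k"] c[of k] by (simp add: Suc_leI)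
  ultimately have det_B: "\<bar>det (B k)\<bar> \<le> inverse (real (Suc k))" for k
    using c(3)[of k] by (metis order_trans)
  have lim_det: "(\<lambda>k. det (B k)) \<longlonglongrightarrow> 0"
    by (rule Lim_null_comparison[OF _ LIMSEQ_inverse_real_of_nat]) (use det_B in simp)
  obtain A r where A: "A \<in> sphere 0 1" "strict_mono (r :: nat \<Rightarrow> nat)" "(B \<circ> r) \<longlonglongrightarrow> A"
    using compact_sphere[of "0 :: real^'n^'n" 1] norm_B
    unfolding compact_def by (metis mem_sphere_0)
  have "(\<lambda>k. det ((B \<circ> r) k)) \<longlonglongrightarrow> det A"
    using A(3) by (rule tendsto_det)
  moreover have "(\<lambda>k. det ((B \<circ> r) k)) \<longlonglongrightarrow> 0"
    using LIMSEQ_subseq_LIMSEQ[OF lim_det A(2)] by (simp add: o_def)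
  ultimately have "det A = 0"
    using LIMSEQ_unique by blast
  then obtain v where v: "v \<noteq> 0" "A *v v = 0"
    by (metis invertible_det_nz invertible_left_inverse matrix_left_invertible_ker)
  have "A \<noteq> 0" using A(1) by auto
  then obtain x where x: "A *v x \<noteq> 0"
    by (metis matrix_eq matrix_vector_mult_0)
  have Axv: "A *v (x + v) = A *v x"
    using v by (simp add: matrix_vector_right_distrib)
  then have nz: "x \<noteq> 0" "x + v \<noteq> 0"
    using x by (auto simp: matrix_vector_mult_0_right)
  define p q where "p = x /\<^sub>R norm x" and "q = (x + v) /\<^sub>R norm (x + v)"
  have pq: "p \<in> sphere 0 1" "q \<in> sphere 0 1"
    using nz by (auto simp: p_def q_def)
  \<comment> \<open>\<open>A\<close> maps \<open>p\<close> and \<open>q\<close> to multiples of the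
    same nonzero vector \<open>A *v x\<close>. If \<open>p = q\<close>, the two factors agree, so
    \<open>x\<close> and \<open>x + v\<close> have equal norms and \<open>v\<close> would
    vanish.\<close>
  have "p \<noteq> q"
  proof
    assume "p = q"
    then have "A *v p = A *v q" by simp
    then have "inverse (norm x) *\<^sub>R (A *v x) = inverse (norm (x + v)) *\<^sub>R (A *v x)"
      by (simp add: p_def q_def matrix_vector_mult_scaleR Axv)
    then have "norm x = norm (x + v)" using x by simp
    with \<open>p = q\<close> have "x = x + v"
      using nz by (simp add: p_def q_def)
    with v show False by simp
  qed
  have sphere_B: "sphere_map (B k) z = sphere_map (T k) z" for k z
    using c(1)[of k] det_T[of k] by (simp add: B_def sphere_map_scaleR sphere_map_det_normalize)
  have map_pq: "sphere_map C p = sphere_map C x" "sphere_map C q = sphere_map C (x + v)"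
    for C :: "real^'n^'n"
    using nz by (simp_all add: p_def q_def sphere_map_scaleR_right)
  have "(\<lambda>k. sphere_map ((B \<circ> r) k) x) \<longlonglongrightarrow> sphere_map A x"
    by (rule tendsto_sphere_map[OF A(3) x])
  then have lim_p: "(\<lambda>k. sphere_map (T (r k)) p) \<longlonglongrightarrow> sphere_map A x"
    by (simp add: sphere_B map_pq)
  have "(\<lambda>k. sphere_map ((B \<circ> r) k) (x + v)) \<longlonglongrightarrow> sphere_map A (x + v)"
    by (rule tendsto_sphere_map[OF A(3)]) (simp add: Axv x)
  moreover have "sphere_map A (x + v) = sphere_map A x"
    by (simp add: sphere_map_def Axv)
  ultimately have lim_q: "(\<lambda>k. sphere_map (T (r k)) q) \<longlonglongrightarrow> sphere_map A x"
    by (simp add: sphere_B map_pq)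
  \<comment> \<open>Needed because the closure in \<open>acts_distally_sphere_iff\<close> is taken
    of pairs cut down to the product of spheres.\<close>
  have "sphere_map (T (r k)) z \<in> sphere 0 1" if "z \<in> sphere 0 1" for k z
    using that by (intro sphere_map_in_sphere det_T) auto
  then have "(sphere_map A x, sphere_map A x) \<in> closure (sphere 0 1 \<times> sphere 0 1 \<inter>
        {(sphere_map T p, sphere_map T q) | T. T \<in> S})"
    unfolding closure_sequential using pq T(1) tendsto_Pair[OF lim_p lim_q]
    by (intro exI[of _ "\<lambda>k. (sphere_map (T (r k)) p, sphere_map (T (r k)) q)"]) blast
  moreover have "sphere_map A x \<in> sphere 0 1"
    using x by (simp add: sphere_map_def)
  ultimately show False
    using distal pq \<open>p \<noteq> q\<close> unfolding acts_distally_sphere_iff by blast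
qed

text \<open>The orbit of a pair lies in the image of \<open>K\<close> under
  \<open>T \<mapsto> (sphere_map T x, sphere_map T y)\<close>. This image is compact, hence closed,
  and it misses the diagonal because every matrix in \<open>K\<close> is invertible and so acts
  injectively.\<close>

lemma acts_distally_if_compact:
  fixes S :: "(real^'n^'n) set"
  assumes S: "S \<subseteq> carrier GL" and K: "compact K" "K \<subseteq> carrier GL" "det_normalize ` S \<subseteq> K"
  shows "acts_distally S sphere_map (top_of_set (sphere 0 1))"
  unfolding acts_distally_sphere_iff
proof (intro ballI impI)
  fix x y d :: "real^'n"
  assume xy: "x \<in> sphere 0 1" "y \<in> sphere 0 1" "x \<noteq> y"
  let ?P = "(\<lambda>T. (sphere_map T x, sphere_map T y)) ` K"
  have "continuous_on K (\<lambda>T. (sphere_map T x, sphere_map T y))"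
    unfolding sphere_map_def using xy K(2)
    by (intro continuous_intros continuous_on_matrix_vector_mult_left)
       (auto simp: matrix_vector_mult_eq_0_iff subset_iff mem_carrier_GL)
  then have "closed ?P"
    using K(1) by (intro compact_imp_closed compact_continuous_image)
  \<comment> \<open>\<open>T\<close> itself may lie outside \<open>K\<close>; its normalisation lies
    in \<open>K\<close> and acts in the same way.\<close>
  moreover have "(sphere_map T x, sphere_map T y) \<in> ?P" if "T \<in> S" for T
    using that S K(3)
    by (intro image_eqI[of _ _ "det_normalize T"])
       (auto simp: sphere_map_det_normalize subset_iff mem_carrier_GL)
  ultimately have "closure (sphere 0 1 \<times> sphere 0 1 \<inter>
      {(sphere_map T x, sphere_map T y) | T. T \<in> S}) \<subseteq> ?P"
    by (intro closure_minimal) auto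
  moreover have "(d, d) \<notin> ?P"
    using sphere_map_inj xy K(2) by (auto simp: subset_iff mem_carrier_GL)
  ultimately show "(d, d) \<notin> closure (sphere 0 1 \<times> sphere 0 1 \<inter>
      {(sphere_map T x, sphere_map T y) | T. T \<in> S})"
    by blast
qed

section \<open>Compact semigroups of matrices\<close>

text \<open>If \<open>g ^ m\<^sub>k\<close> converges to \<open>L\<close> and \<open>g ^ (m\<^sub>k\<^sub>+\<^sub>2 - m\<^sub>k - 1)\<close> to \<open>M\<close>, then \<open>L g M = L\<close>, so \<open>M\<close> inverts \<open>g\<close>.\<close>

lemma compact_semigroup_inverse:
  fixes K :: "(real^'n^'n) set"
  assumes K: "compact K" "K \<subseteq> carrier GL" and mult: "\<And>A B. A \<in> K \<Longrightarrow> B \<in> K \<Longrightarrow> A ** B \<in> K"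
    and g: "g \<in> K"
  obtains M where "M \<in> K" "g ** M = mat 1"
proof -
  \<comment> \<open>\<open>p k\<close> is the power of \<open>g\<close> with exponent
    \<open>k + 1\<close>. Starting at exponent 1 keeps all powers in \<open>K\<close>, which is not
    known to contain \<open>mat 1\<close> yet.\<close>
  define p where "p k = ((**) g ^^ k) g" for k
  have p_K: "p k \<in> K" for k
    by (induction k) (auto simp: p_def g mult)
  have p_add: "p (Suc (i + j)) = p i ** p j" for i j
    by (induction i) (simp_all add: p_def matrix_mul_assoc)
  obtain L m where L: "L \<in> K" "strict_mono (m :: nat \<Rightarrow> nat)" "(p \<circ> m) \<longlonglongrightarrow> L"
    using K(1) p_K unfolding compact_def by metis
  \<comment> \<open>Jumping two indices makes the gap in \<open>m\<close> at least 2. Hence the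
    natural subtraction does not truncate, and \<open>q k\<close> is a power with positive exponent
    even after one factor \<open>g\<close> is split off.\<close>
  define q where "q k = p (m (Suc (Suc k)) - m k - 2)" for k
  have gap: "m (Suc (Suc k)) \<ge> m k + 2" for k
    using strict_monoD[OF L(2), of k "Suc k"] strict_monoD[OF L(2), of "Suc k" "Suc (Suc k)"] by simp
  obtain M s where M: "M \<in> K" "strict_mono (s :: nat \<Rightarrow> nat)" "(q \<circ> s) \<longlonglongrightarrow> M"
    using K(1) p_K unfolding compact_def q_def by metis
  define h where "h k = p (m (Suc (Suc k)))" for k
  have "h k = p (m k) ** (g ** q k)" for k
  proof -
    have "g ** q k = p (Suc (0 + (m (Suc (Suc k)) - m k - 2)))"
      unfolding p_add q_def by (simp add: p_def)
    then have "p (m k) ** (g ** q k) = p (Suc (m k + Suc (m (Suc (Suc k)) - m k - 2)))"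
      by (simp only: p_add add_0)
    moreover have "Suc (m k + Suc (m (Suc (Suc k)) - m k - 2)) = m (Suc (Suc k))"
      using gap[of k] by linarith
    ultimately show ?thesis by (simp only: h_def)
  qed
  then have "(h \<circ> s) = (\<lambda>k. ((p \<circ> m) \<circ> s) k ** (g ** (q \<circ> s) k))"
    by (auto simp: fun_eq_iff)
  moreover have "(\<lambda>k. ((p \<circ> m) \<circ> s) k ** (g ** (q \<circ> s) k)) \<longlonglongrightarrow> L ** (g ** M)"
    using M(3) LIMSEQ_subseq_LIMSEQ[OF L(3) M(2)] by (intro tendsto_intros)
  moreover have "(h \<circ> s) \<longlonglongrightarrow> L"
  proof -
    have "h \<longlonglongrightarrow> L"
      using LIMSEQ_Suc[OF LIMSEQ_Suc[OF L(3)]] by (simp add: h_def[abs_def] o_def)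
    then show ?thesis using M(2) by (rule LIMSEQ_subseq_LIMSEQ)
  qed
  ultimately have "L ** (g ** M) = L"
    using LIMSEQ_unique by metis
  moreover obtain L' where "L' ** L = mat 1"
    using L(1) K(2) by (auto simp: GL_def invertible_def subset_iff)
  ultimately have "g ** M = mat 1"
    by (metis matrix_mul_assoc matrix_mul_lid)
  with M(1) that show ?thesis by blast
qed

lemma subgroup_GL_if_compact_semigroup:
  fixes K :: "(real^'n^'n) set"
  assumes "compact K" "K \<subseteq> carrier GL" "K \<noteq> {}"
    and "\<And>A B. A \<in> K \<Longrightarrow> B \<in> K \<Longrightarrow> A ** B \<in> K"
  shows "subgroup K GL"
proof -
  interpret group "GL :: (real^'n^'n) monoid" by (rule group_GL)
  show ?thesis
  proof (rule subgroupI)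
    show "K \<subseteq> carrier GL" "K \<noteq> {}"
      by (rule assms(2), rule assms(3))
    show "a \<otimes>\<^bsub>GL\<^esub> b \<in> K" if "a \<in> K" "b \<in> K" for a b
      unfolding mult_GL using that by (rule assms(4))
    fix a assume a: "a \<in> K"
    obtain M where M: "M \<in> K" "a ** M = mat 1"
      using compact_semigroup_inverse[OF assms(1,2,4) a] .
    \<comment> \<open>\<open>inv_equality\<close> asks for a left inverse while \<open>M\<close> is
      a right inverse; for square matrices the two coincide.\<close>
    have "inv\<^bsub>GL\<^esub> a = M"
      by (rule inv_equality)
         (use M a assms(2) matrix_left_right_inverse in \<open>auto simp: GL_def\<close>)
    with M show "inv\<^bsub>GL\<^esub> a \<in> K" by simp
  qed
qed

section \<open>The closure of the normalised semigroup in the general linear group\<close>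

lemma abs_det_closure_det_normalize:
  fixes S :: "(real^'n^'n) set"
  assumes "S \<subseteq> carrier GL" "A \<in> closure (det_normalize ` S)"
  shows "\<bar>det A\<bar> = 1"
proof -
  have "closed {A :: real^'n^'n. \<bar>det A\<bar> = 1}"
    by (intro closed_Collect_eq continuous_intros)
  then have "closure (det_normalize ` S) \<subseteq> {A. \<bar>det A\<bar> = 1}"
    using assms(1) by (intro closure_minimal) (auto simp: abs_det_det_normalize mem_carrier_GL subset_iff)
  with assms(2) show ?thesis by auto
qed

text \<open>The invertible matrices are not closed among all matrices, but the closed condition
  \<open>\<bar>det A\<bar> = 1\<close> keeps limits of normalised matrices invertible. The relative
  closure is thus the Euclidean one, and compactness reduces to boundedness.\<close>

lemma GL_closure_of_det_normalize:
  assumes "S \<subseteq> carrier GL"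
  shows "GL_topology closure_of (det_normalize ` S) = closure (det_normalize ` S)"
proof -
  have "closure (det_normalize ` S) \<subseteq> carrier GL"
    using abs_det_closure_det_normalize[OF assms] by (force simp: mem_carrier_GL)
  moreover from this have "det_normalize ` S \<subseteq> carrier GL"
    using closure_subset by blast
  ultimately show ?thesis
    by (simp add: GL_topology_def closure_of_subtopology Int_absorb1 Int_absorb2)
qed

lemma compactin_GL_topology: "compactin GL_topology K \<longleftrightarrow> compact K \<and> K \<subseteq> carrier GL"
  by (simp add: GL_topology_def compactin_subtopology)

lemma compact_group_GL_iff:
  fixes S :: "(real^'n^'n) set"
  assumes S: "matrix_semigroup S"
  shows "compact_group_in GL GL_topology (GL_topology closure_of (det_normalize ` S)) \<longleftrightarrow>
    bounded (det_normalize ` S)"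
proof
  let ?K = "closure (det_normalize ` S)"
  have SGL: "S \<subseteq> carrier GL" and ne: "S \<noteq> {}" using S by (auto simp: matrix_semigroup_def)
  note cl = GL_closure_of_det_normalize[OF SGL]
  {
    assume "compact_group_in GL GL_topology (GL_topology closure_of (det_normalize ` S))"
    then have "compact ?K"
      by (simp add: compact_group_in_def cl compactin_GL_topology)
    then show "bounded (det_normalize ` S)"
      by (meson bounded_subset closure_subset compact_imp_bounded)
  next
    assume "bounded (det_normalize ` S)"
    then have K: "compact ?K" by (simp add: compact_closure)
    have KGL: "?K \<subseteq> carrier GL"
      using abs_det_closure_det_normalize[OF SGL] by (force simp: mem_carrier_GL)
    \<comment> \<open>Normalisation is multiplicative, so the normalised matrices form a semigroup;
      continuity of the product carries this over to limits.\<close>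
    have "A ** B \<in> ?K" if "A \<in> ?K" "B \<in> ?K" for A B
    proof -
      obtain f g where fg: "\<And>k. f k \<in> det_normalize ` S" "f \<longlonglongrightarrow> A"
          "\<And>k. g k \<in> det_normalize ` S" "g \<longlonglongrightarrow> B"
        using \<open>A \<in> ?K\<close> \<open>B \<in> ?K\<close> unfolding closure_sequential by metis
      have "f k ** g k \<in> det_normalize ` S" for k
        using fg(1)[of k] fg(3)[of k] S
        by (auto simp: matrix_semigroup_def simp flip: det_normalize_mult)
      moreover have "(\<lambda>k. f k ** g k) \<longlonglongrightarrow> A ** B"
        using fg(2,4) by (rule tendsto_matrix_matrix_mult)
      ultimately show ?thesis
        unfolding closure_sequential by (intro exI[of _ "\<lambda>k. f k ** g k"]) auto
    qed
    then have "subgroup ?K GL"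
      using K KGL ne by (intro subgroup_GL_if_compact_semigroup) auto
    then show "compact_group_in GL GL_topology (GL_topology closure_of (det_normalize ` S))"
      using K KGL by (simp add: compact_group_in_def cl compactin_GL_topology)
  }
qed

section \<open>The quotient by the scalars\<close>

lemma r_coset_scalars: "scalars #>\<^bsub>GL\<^esub> A = {r *\<^sub>R A | r. r \<noteq> 0}"
  by (auto simp: r_coset_def scalars_def mult_GL simp flip: scalar_matrix_assoc)

lemma r_coset_scalars_scaleR:
  assumes "r \<noteq> 0"
  shows "scalars #>\<^bsub>GL\<^esub> (r *\<^sub>R A) = scalars #>\<^bsub>GL\<^esub> A"
proof -
  have "\<exists>t. s *\<^sub>R A = (t * r) *\<^sub>R A \<and> t \<noteq> 0" if "s \<noteq> 0" for s
    using that assms by (intro exI[of _ "s / r"]) auto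
  then show ?thesis
    using assms by (auto simp: r_coset_scalars)
qed

lemma r_coset_scalars_eqD:
  assumes "scalars #>\<^bsub>GL\<^esub> A = scalars #>\<^bsub>GL\<^esub> B"
  obtains r where "r \<noteq> 0" "A = r *\<^sub>R B"
proof -
  have "A \<in> scalars #>\<^bsub>GL\<^esub> A"
    unfolding r_coset_scalars by (auto intro: exI[of _ 1])
  with assms that show ?thesis by (auto simp: r_coset_scalars)
qed

lemma r_coset_scalars_det_normalize:
  assumes "det A \<noteq> 0"
  shows "scalars #>\<^bsub>GL\<^esub> det_normalize A = scalars #>\<^bsub>GL\<^esub> A"
  by (rule det_normalize_scaled[OF assms]) (simp add: r_coset_scalars_scaleR)

text \<open>Multiplying by scalars and normalising both move a matrix within its coset. The quotient
  condition can therefore be studied on the normalised semigroup.\<close>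

lemma image_r_coset_set_mult_scalars:
  fixes S :: "(real^'n^'n) set"
  assumes "S \<subseteq> carrier GL"
  shows "(\<lambda>A. scalars #>\<^bsub>GL\<^esub> A) ` (S <#>\<^bsub>GL\<^esub> scalars) = (\<lambda>A. scalars #>\<^bsub>GL\<^esub> A) ` det_normalize ` S"
proof -
  let ?\<pi> = "\<lambda>A :: real^'n^'n. scalars #>\<^bsub>GL\<^esub> A"
  have *: "A ** (r *\<^sub>R mat 1) = r *\<^sub>R A" for r and A :: "real^'n^'n"
    using scaleR_matrix_mult[of 1 A r "mat 1"] by simp
  have "S <#>\<^bsub>GL\<^esub> scalars = {A ** (r *\<^sub>R mat 1) | r A. r \<noteq> 0 \<and> A \<in> S}"
    unfolding set_mult_def scalars_def mult_GL by blast
  then have eq: "S <#>\<^bsub>GL\<^esub> scalars = {r *\<^sub>R A | r A. r \<noteq> 0 \<and> A \<in> S}"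
    by (simp only: *)
  have "?\<pi> ` (S <#>\<^bsub>GL\<^esub> scalars) = ?\<pi> ` S"
  proof
    show "?\<pi> ` (S <#>\<^bsub>GL\<^esub> scalars) \<subseteq> ?\<pi> ` S"
      unfolding eq by (auto simp: r_coset_scalars_scaleR)
    have "A \<in> S <#>\<^bsub>GL\<^esub> scalars" if "A \<in> S" for A
      unfolding eq using that by (intro CollectI exI[of _ 1] exI[of _ A]) simp
    then show "?\<pi> ` S \<subseteq> ?\<pi> ` (S <#>\<^bsub>GL\<^esub> scalars)"
      by (intro image_mono subsetI)
  qed
  also have "\<dots> = (\<lambda>A. scalars #>\<^bsub>GL\<^esub> A) ` det_normalize ` S"
    unfolding image_image using assms
    by (intro image_cong) (auto simp: r_coset_scalars_det_normalize mem_carrier_GL subset_iff)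
  finally show ?thesis .
qed

text \<open>The sign left over by \<open>det_normalize_scaleR\<close> disappears in the norm, which
  therefore descends to a function on the quotient.\<close>

lemma norm_det_normalize_coset:
  assumes "scalars #>\<^bsub>GL\<^esub> A = scalars #>\<^bsub>GL\<^esub> B"
  shows "norm (det_normalize A) = norm (det_normalize B)"
  by (rule r_coset_scalars_eqD[OF assms]) (auto simp: det_normalize_scaleR abs_sgn_eq)

text \<open>The sets \<open>{A. norm (det_normalize A) < m}\<close> are open and saturated, so they
  descend to an increasing open cover of the quotient.\<close>

lemma bounded_det_normalize_if_compact_quotient:
  fixes S :: "(real^'n^'n) set"
  assumes S: "S \<subseteq> carrier GL" and C: "compactin PGL_topology C"
    and sub: "(\<lambda>A. scalars #>\<^bsub>GL\<^esub> A) ` det_normalize ` S \<subseteq> C"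
  shows "bounded (det_normalize ` S)"
proof -
  let ?\<pi> = "\<lambda>A :: real^'n^'n. scalars #>\<^bsub>GL\<^esub> A"
  define U where "U m = {A \<in> carrier GL. norm (det_normalize (A::real^'n^'n)) < real m}" for m
  have "openin GL_topology (U m)" for m
    unfolding U_def GL_topology_def
    using continuous_on_open_gen[of "\<lambda>A. norm (det_normalize (A::real^'n^'n))" "carrier GL" UNIV]
      continuous_on_norm[OF continuous_on_det_normalize]
    by (auto simp: vimage_def Int_def dest!: spec[of _ "{..<real m}"])
  moreover have "{A \<in> topspace GL_topology. ?\<pi> A \<in> ?\<pi> ` U m} = U m" for m
    by (auto simp: U_def GL_topology_def dest: norm_det_normalize_coset)
  ultimately have open_U: "openin PGL_topology (?\<pi> ` U m)" for m
    unfolding PGL_topology_def openin_quotient_topology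
    by (auto simp: U_def GL_topology_def)
  have "C \<subseteq> topspace PGL_topology"
    using C by (rule compactin_subset_topspace)
  also have "\<dots> = ?\<pi> ` carrier GL"
    by (simp add: PGL_topology_def GL_topology_def)
  also have "carrier GL = (\<Union>m. U m)"
    unfolding U_def using reals_Archimedean2 by blast
  finally have "C \<subseteq> \<Union>(range (\<lambda>m. ?\<pi> ` U m))"
    by (simp only: image_UN)
  with C open_U obtain \<F> where \<F>: "finite \<F>" "\<F> \<subseteq> range (\<lambda>m. ?\<pi> ` U m)" "C \<subseteq> \<Union>\<F>"
    using compactinD[of PGL_topology C "range (\<lambda>m. ?\<pi> ` U m)"] by blast
  then obtain N where N: "finite N" "\<F> = (\<lambda>m. ?\<pi> ` U m) ` N"
    by (metis finite_subset_image)
  \<comment> \<open>The sets \<open>U m\<close> increase with \<open>m\<close>, so the largest index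
    of the finite subcover bounds all \<open>B\<close>. Any such \<open>B\<close> provides an
    element of \<open>N\<close>, so \<open>Max N\<close> is meaningful here.\<close>
  have "norm B \<le> real (Max N)" if B: "B \<in> det_normalize ` S" for B
  proof -
    obtain m where m: "m \<in> N" "?\<pi> B \<in> ?\<pi> ` U m"
      using sub B \<F>(3) N(2) by blast
    then have "norm (det_normalize B) < real m"
      by (auto simp: U_def dest: norm_det_normalize_coset)
    moreover have "det_normalize B = B"
      using B S by (auto simp: mem_carrier_GL subset_iff intro!: det_normalize_eq_self abs_det_det_normalize)
    moreover have "m \<le> Max N"
      using m(1) N(1) by simp
    ultimately show ?thesis by simp
  qed
  then show ?thesis
    unfolding bounded_iff by blast
qed

text \<open>The closure turns out to be the image of \<open>?K\<close>, which is a compact group as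
  the image of one under a continuous homomorphism. What remains is that this image is closed, and
  this is checked on its preimage under the quotient map.\<close>

lemma compact_group_PGL_if_bounded:
  fixes S :: "(real^'n^'n) set"
  assumes S: "matrix_semigroup S" and bdd: "bounded (det_normalize ` S)"
  shows "compact_group_in (GL Mod scalars) PGL_topology
    (PGL_topology closure_of ((\<lambda>A. scalars #>\<^bsub>GL\<^esub> A) ` det_normalize ` S))"
proof -
  let ?\<pi> = "\<lambda>A :: real^'n^'n. scalars #>\<^bsub>GL\<^esub> A"
  let ?K = "closure (det_normalize ` S)"
  interpret scalars: normal "scalars :: (real^'n^'n) set" GL by (rule scalars_normal)
  have SGL: "S \<subseteq> carrier GL" using S by (simp add: matrix_semigroup_def)
  have K: "subgroup ?K GL" "compactin GL_topology ?K"
    using bdd unfolding compact_group_GL_iff[OF S, symmetric]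
    by (auto simp: compact_group_in_def GL_closure_of_det_normalize[OF SGL])
  have det_K: "\<bar>det A\<bar> = 1" if "A \<in> ?K" for A
    using abs_det_closure_det_normalize[OF SGL that] .
  have qm: "quotient_map GL_topology PGL_topology ?\<pi>"
    unfolding PGL_topology_def by (rule quotient_map_quotient_topology)
  have cont: "continuous_map GL_topology PGL_topology ?\<pi>"
    using qm by (rule quotient_imp_continuous_map)
  have "group_hom GL (GL Mod scalars) ?\<pi>"
    by (simp add: group_hom_def group_hom_axioms_def group_GL scalars.factorgroup_is_group scalars.r_coset_hom_Mod)
  then have grp: "subgroup (?\<pi> ` ?K) (GL Mod scalars)"
    using K(1) by (rule group_hom.subgroup_img_is_subgroup)
  have cpt: "compactin PGL_topology (?\<pi> ` ?K)"
    using K(2) cont by (rule image_compactin)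
  have preimage: "{A \<in> topspace GL_topology. ?\<pi> A \<in> ?\<pi> ` ?K} =
      carrier GL \<inter> det_normalize -` (?K \<union> uminus ` ?K)"
  proof (intro equalityI subsetI)
    fix A assume "A \<in> {A \<in> topspace GL_topology. ?\<pi> A \<in> ?\<pi> ` ?K}"
    then obtain k where A: "A \<in> carrier GL" and k: "k \<in> ?K" "?\<pi> A = ?\<pi> k"
      by (auto simp: GL_topology_def)
    obtain r where r: "r \<noteq> 0" "A = r *\<^sub>R k"
      using r_coset_scalars_eqD[OF k(2)] .
    then have "det_normalize A = sgn r *\<^sub>R k"
      using det_K[OF k(1)] by (simp add: det_normalize_scaleR det_normalize_eq_self)
    then have "det_normalize A = k \<or> det_normalize A = - k"
      using r(1) by (auto simp: sgn_if)
    with A k(1) show "A \<in> carrier GL \<inter> det_normalize -` (?K \<union> uminus ` ?K)"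
      by auto
  next
    fix A assume "A \<in> carrier GL \<inter> det_normalize -` (?K \<union> uminus ` ?K)"
    then obtain k where A: "A \<in> carrier GL" and k: "k \<in> ?K" "det_normalize A = k \<or> det_normalize A = - k"
      by auto
    have "?\<pi> A = ?\<pi> (det_normalize A)"
      using A by (simp add: r_coset_scalars_det_normalize mem_carrier_GL)
    also have "\<dots> = ?\<pi> k"
    proof -
      have "?\<pi> (- k) = ?\<pi> k"
        using r_coset_scalars_scaleR[of "-1" k] by simp
      then show ?thesis using k(2) by metis
    qed
    finally show "A \<in> {A \<in> topspace GL_topology. ?\<pi> A \<in> ?\<pi> ` ?K}"
      using A k(1) by (auto simp: GL_topology_def)
  qed
  have "closed (?K \<union> uminus ` ?K)"
    using closed_negations by blast
  then have "closedin GL_topology {A \<in> topspace GL_topology. ?\<pi> A \<in> ?\<pi> ` ?K}"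
    unfolding preimage unfolding GL_topology_def
    by (intro continuous_closedin_preimage continuous_on_det_normalize)
  then have "closedin PGL_topology (?\<pi> ` ?K)"
    using qm compactin_subset_topspace[OF cpt] unfolding quotient_map_closedin by blast
  \<comment> \<open>Closedness of the image gives this inclusion by minimality of the closure; the
    reverse one is continuity of the quotient map.\<close>
  then have "PGL_topology closure_of (?\<pi> ` det_normalize ` S) \<subseteq> ?\<pi> ` ?K"
    by (intro closure_of_minimal image_mono closure_subset)
  moreover have "?\<pi> ` ?K \<subseteq> PGL_topology closure_of (?\<pi> ` det_normalize ` S)"
    using continuous_map_image_closure_subset[OF cont, of "det_normalize ` S"]
    by (simp add: GL_closure_of_det_normalize[OF SGL])
  ultimately have "PGL_topology closure_of (?\<pi> ` det_normalize ` S) = ?\<pi> ` ?K"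
    by (rule subset_antisym)
  then show ?thesis
    using grp cpt by (simp add: compact_group_in_def)
qed

lemma compact_group_PGL_iff:
  fixes S :: "(real^'n^'n) set"
  assumes S: "matrix_semigroup S"
  shows "compact_group_in (GL Mod scalars) PGL_topology
      (PGL_topology closure_of ((\<lambda>A. scalars #>\<^bsub>GL\<^esub> A) ` (S <#>\<^bsub>GL\<^esub> scalars))) \<longleftrightarrow>
    bounded (det_normalize ` S)"
proof -
  let ?P = "(\<lambda>A. scalars #>\<^bsub>GL\<^esub> A) ` det_normalize ` S"
  have SGL: "S \<subseteq> carrier GL" using S by (simp add: matrix_semigroup_def)
  then have "det_normalize ` S \<subseteq> carrier GL"
    using abs_det_det_normalize by (force simp: mem_carrier_GL)
  then have "?P \<subseteq> topspace PGL_topology"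
    by (auto simp: PGL_topology_def GL_topology_def)
  then have "?P \<subseteq> PGL_topology closure_of ?P"
    by (rule closure_of_subset)
  then show ?thesis
    unfolding image_r_coset_set_mult_scalars[OF SGL]
    using bounded_det_normalize_if_compact_quotient[OF SGL] compact_group_PGL_if_bounded[OF S]
    by (auto simp: compact_group_in_def)
qed

section \<open>Distality as boundedness, and the final equivalences\<close>

lemma acts_distally_iff_bounded:
  fixes S :: "(real^'n^'n) set"
  assumes S: "matrix_semigroup S"
  shows "acts_distally S sphere_map (top_of_set (sphere 0 1)) \<longleftrightarrow> bounded (det_normalize ` S)"
proof
  have SGL: "S \<subseteq> carrier GL" using S by (simp add: matrix_semigroup_def)
  {
    assume "acts_distally S sphere_map (top_of_set (sphere 0 1))"
    with SGL show "bounded (det_normalize ` S)"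
      by (rule bounded_det_normalize_if_distal)
  next
    assume "bounded (det_normalize ` S)"
    then have "compact (closure (det_normalize ` S))" by (simp add: compact_closure)
    then show "acts_distally S sphere_map (top_of_set (sphere 0 1))"
      using abs_det_closure_det_normalize[OF SGL]
      by (intro acts_distally_if_compact[OF SGL _ _ closure_subset]) (force simp: mem_carrier_GL)+
  }
qed

theorem theorem1:
  fixes S :: "(real^'d^'d) set" and n :: nat
  assumes "n \<ge> 1" and "CARD('d) = n + 1"
    and "matrix_semigroup S"
  shows "(acts_distally S sphere_map (top_of_set (sphere 0 1)) \<longleftrightarrow>
          compact_group_in (GL Mod scalars) PGL_topology
            (PGL_topology closure_of ((\<lambda>A. scalars #>\<^bsub>GL\<^esub> A) ` (S <#>\<^bsub>GL\<^esub> scalars))))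
       \<and> (acts_distally S sphere_map (top_of_set (sphere 0 1)) \<longleftrightarrow>
          compact_group_in GL GL_topology (GL_topology closure_of (det_normalize ` S)))"
  using assms(3) by (simp add: acts_distally_iff_bounded compact_group_PGL_iff compact_group_GL_iff)

end
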